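(* For every integer $r \geq 1$, there exists a binary $r$-uniform family $\mathcal{F} \subseteq [\mathbb{N} \rightharpoonup 2]$ of size $2^r$ without an $\mathcal{F}$-coloring.
   Context: The integer $2$ is identified with the set $\{0,1\}$, and functions are identified with their graphs (so $\varphi \subseteq f$ means that $f$ extends $\varphi$). $[X \rightharpoonup 2]$ denotes the set of all partial maps from $X$ to $\{0,1\}$, i.e. functions $\varphi$ defined on a subset $\mathrm{dom}(\varphi)$ of $X$ with values in $\{0,1\}$. For a family $\mathcal{F} \subseteq [X \rightharpoonup 2]$: $\mathrm{dom}(\mathcal{F}) := \{\mathrm{dom}(\varphi) : \varphi \in \mathcal{F}\}$; $\mathcal{F}$ is $r$-uniform if $|\mathrm{dom}(\varphi)| = r$ for all $\varphi \in \mathcal{F}$; $\mathcal{F}$ is binary if for all $e \in \mathrm{dom}(\mathcal{F})$ we have $|\{\varphi \in \mathcal{F} : \mathrm{dom}(\varphi) = e\}| \leq 2$. An $\mathcal{F}$-coloring is a (total) function $f \colon X \to \{0,1\}$ such that $\varphi \not\subseteq f$ for all $\varphi \in \mathcal{F}$. *)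

theory Defs
  imports Main
begin

text \<open>
  The set \<open>2 = {0, 1}\<close> is rendered as \<^typ>\<open>bool\<close>, the ground set \<open>X\<close> as a type \<open>'a\<close>, and a partial
  map from \<open>X\<close> to \<open>2\<close> as an element of \<open>'a \<rightharpoonup> bool\<close>.  A total function \<open>f\<close> corresponds to the
  map \<open>Some \<circ> f\<close>, and containment of graphs is \<^const>\<open>map_le\<close>.
\<close>

text \<open>
  The finiteness conjuncts below exclude infinite sets, to which \<^const>\<open>card\<close> assigns \<open>0\<close>.
\<close>

definition uniform :: "nat \<Rightarrow> ('a \<rightharpoonup> bool) set \<Rightarrow> bool" where
  "uniform r F \<longleftrightarrow> (\<forall>\<phi>\<in>F. finite (dom \<phi>) \<and> card (dom \<phi>) = r)"

definition binary :: "('a \<rightharpoonup> bool) set \<Rightarrow> bool" where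
  "binary F \<longleftrightarrow> (\<forall>e \<in> dom ` F. finite {\<phi> \<in> F. dom \<phi> = e} \<and> card {\<phi> \<in> F. dom \<phi> = e} \<le> 2)"

definition coloring :: "('a \<rightharpoonup> bool) set \<Rightarrow> ('a \<Rightarrow> bool) \<Rightarrow> bool" where
  "coloring F f \<longleftrightarrow> (\<forall>\<phi>\<in>F. \<not> \<phi> \<subseteq>\<^sub>m (Some \<circ> f))"

end

theory Submission
  imports Defs
begin

text \<open>
  A complete binary decision tree of depth \<open>r\<close> that queries a different variable at each of its inner
  nodes has \<open>2 ^ r\<close> leaves. The leaves, read as the partial maps of queried variables to answers,
  form the required family. A total function \<open>f\<close> answers every query, so it follows a branch to some
  leaf and extends the partial map of that leaf; hence there is no coloring. A leaf's domain contains
  the variable queried at its parent, which is queried on no other branch than the two that pass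
  through that parent; hence only siblings share a domain, and the family is binary.

  The tree is grown from the root by one level at a time: the leaf \<open>\<phi>\<close> is replaced by
  its two extensions to a fresh variable \<open>v \<phi>\<close>.
\<close>

definition branch :: "(('a \<rightharpoonup> bool) \<Rightarrow> 'a) \<Rightarrow> ('a \<rightharpoonup> bool) set \<Rightarrow> ('a \<rightharpoonup> bool) set" where
  "branch v F = (\<lambda>(\<phi>, b). \<phi>(v \<phi> \<mapsto> b)) ` (F \<times> UNIV)"

lemma branch_not_colorable:
  assumes "\<nexists>f. coloring F f"
  shows "\<nexists>f. coloring (branch v F) f"
proof
  assume "\<exists>f. coloring (branch v F) f"
  then obtain f where f: "coloring (branch v F) f" ..
  from assms obtain \<phi> where \<phi>: "\<phi> \<in> F" "\<phi> \<subseteq>\<^sub>m Some \<circ> f"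
    by (auto simp: coloring_def)
  \<comment> \<open>Follow the answer that \<open>f\<close> itself gives to the new query.\<close>
  have "\<phi>(v \<phi> \<mapsto> f (v \<phi>)) \<in> branch v F"
    using \<phi>(1) by (force simp: branch_def)
  moreover have "\<phi>(v \<phi> \<mapsto> f (v \<phi>)) \<subseteq>\<^sub>m Some \<circ> f"
    using \<phi>(2) by (auto simp: map_le_def)
  ultimately show False
    using f by (auto simp: coloring_def)
qed

lemma branch_uniform:
  assumes "uniform r F" and "\<And>\<phi>. \<phi> \<in> F \<Longrightarrow> v \<phi> \<notin> dom \<phi>"
  shows "uniform (Suc r) (branch v F)"
  using assms by (auto simp: uniform_def branch_def)

text \<open>
  The freshness of the new variables with respect to every member of the family, and not only to the
  one that it extends, makes \<open>v \<phi>\<close> recognizable in the domain of an extension of \<open>\<phi>\<close>: for no other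
  member \<open>\<psi>\<close> does it occur in \<open>dom \<psi>\<close> or equal \<open>v \<psi>\<close>.
\<close>

lemma parent_eq_if_extensions_share_domain:
  assumes inj: "inj_on v F"
    and fresh: "\<And>\<phi> \<psi>. \<phi> \<in> F \<Longrightarrow> \<psi> \<in> F \<Longrightarrow> v \<phi> \<notin> dom \<psi>"
    and mem: "\<phi> \<in> F" "\<psi> \<in> F"
    and eq: "dom (\<phi>(v \<phi> \<mapsto> b)) = dom (\<psi>(v \<psi> \<mapsto> c))"
  shows "\<phi> = \<psi>"
proof -
  have "v \<phi> \<in> dom (\<psi>(v \<psi> \<mapsto> c))"
    unfolding eq[symmetric] by simp
  with fresh[OF mem] have "v \<phi> = v \<psi>" by auto
  with inj mem show ?thesis by (auto dest: inj_onD)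
qed

lemma branch_card:
  assumes "inj_on v F"
    and "\<And>\<phi> \<psi>. \<phi> \<in> F \<Longrightarrow> \<psi> \<in> F \<Longrightarrow> v \<phi> \<notin> dom \<psi>"
  shows "card (branch v F) = 2 * card F"
proof -
  have "inj_on (\<lambda>(\<phi>, b). \<phi>(v \<phi> \<mapsto> b)) (F \<times> UNIV)"
  proof (rule inj_onI, clarify)
    fix \<phi> \<psi> b c
    assume mem: "\<phi> \<in> F" "\<psi> \<in> F" and eq: "\<phi>(v \<phi> \<mapsto> b) = \<psi>(v \<psi> \<mapsto> c)"
    have "\<phi> = \<psi>"
      using parent_eq_if_extensions_share_domain[OF assms mem] eq by metis
    with eq show "\<phi> = \<psi> \<and> b = c" by (auto dest: map_upd_eqD1)
  qed
  then show ?thesis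
    by (simp add: branch_def card_image card_cartesian_product)
qed

lemma branch_binary:
  assumes "inj_on v F"
    and "\<And>\<phi> \<psi>. \<phi> \<in> F \<Longrightarrow> \<psi> \<in> F \<Longrightarrow> v \<phi> \<notin> dom \<psi>"
  shows "binary (branch v F)"
  unfolding binary_def
proof
  fix e assume "e \<in> dom ` branch v F"
  then obtain \<phi> b where \<phi>: "\<phi> \<in> F" and e: "e = dom (\<phi>(v \<phi> \<mapsto> b))"
    by (auto simp: branch_def)
  let ?S = "{\<psi> \<in> branch v F. dom \<psi> = e}"
  let ?P = "{\<phi>(v \<phi> \<mapsto> True), \<phi>(v \<phi> \<mapsto> False)}"
  have sub: "?S \<subseteq> ?P"
  proof
    fix \<chi> assume "\<chi> \<in> ?S"
    then have "\<chi> \<in> branch v F" and dom: "dom \<chi> = e"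
      by blast+
    then obtain \<psi> c where \<psi>: "\<psi> \<in> F" "\<chi> = \<psi>(v \<psi> \<mapsto> c)"
      by (auto simp: branch_def)
    have "\<psi> = \<phi>"
      using parent_eq_if_extensions_share_domain[OF assms \<psi>(1) \<phi>] dom
      unfolding \<psi>(2) e by metis
    with \<psi>(2) show "\<chi> \<in> ?P" by (cases c) auto
  qed
  moreover have "card ?P \<le> 2"
    by (simp add: card_insert_if)
  ultimately show "finite ?S \<and> card ?S \<le> 2"
    by (meson card_mono finite.emptyI finite.insertI finite_subset le_trans)
qed

lemma ex_fresh_variables:
  fixes F :: "(nat \<rightharpoonup> 'b) set"
  assumes "finite F" and "\<And>\<phi>. \<phi> \<in> F \<Longrightarrow> finite (dom \<phi>)"
  obtains v where "inj_on v F" and "\<And>\<phi> \<psi>. \<phi> \<in> F \<Longrightarrow> \<psi> \<in> F \<Longrightarrow> v \<phi> \<notin> dom \<psi>"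
proof -
  obtain i :: "(nat \<rightharpoonup> 'b) \<Rightarrow> nat" where i: "inj_on i F"
    using finite_imp_inj_to_nat_seg[OF assms(1)] by blast
  have "finite (\<Union>\<psi>\<in>F. dom \<psi>)"
    using assms by blast
  then obtain N where N: "\<And>x \<psi>. \<psi> \<in> F \<Longrightarrow> x \<in> dom \<psi> \<Longrightarrow> x < N"
    unfolding finite_nat_set_iff_bounded by blast
  show thesis
  proof (rule that[of "\<lambda>\<phi>. N + i \<phi>"])
    show "inj_on (\<lambda>\<phi>. N + i \<phi>) F"
      using i by (simp add: inj_on_def)
    show "N + i \<phi> \<notin> dom \<psi>" if "\<psi> \<in> F" for \<phi> \<psi>
      using N[OF that, of "N + i \<phi>"] by linarith
  qed
qed

theorem theorem1p21:
  fixes r :: nat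
  assumes "r \<ge> 1"
  shows "\<exists>F :: (nat \<rightharpoonup> bool) set.
    binary F \<and> uniform r F \<and> finite F \<and> card F = 2 ^ r \<and> (\<nexists>f. coloring F f)"
proof (induction r)
  case 0
  \<comment> \<open>The tree consisting of its root alone: every function extends the empty map.\<close>
  let ?F = "{Map.empty} :: (nat \<rightharpoonup> bool) set"
  have "{\<phi> \<in> ?F. dom \<phi> = {}} = ?F" by auto
  then have "binary ?F" by (simp add: binary_def)
  then show ?case
    by (intro exI[of _ ?F]) (simp add: uniform_def coloring_def)
next
  case (Suc r)
  then obtain F :: "(nat \<rightharpoonup> bool) set" where F: "uniform r F" "finite F" "card F = 2 ^ r"
      and not_colorable: "\<nexists>f. coloring F f"
    by blast
  obtain v where v: "inj_on v F" "\<And>\<phi> \<psi>. \<phi> \<in> F \<Longrightarrow> \<psi> \<in> F \<Longrightarrow> v \<phi> \<notin> dom \<psi>"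
    using ex_fresh_variables[OF F(2)] F(1) unfolding uniform_def by metis
  have "finite (branch v F)"
    using F(2) by (simp add: branch_def)
  moreover have "card (branch v F) = 2 ^ Suc r"
    using branch_card[OF v] F(3) by simp
  moreover have "uniform (Suc r) (branch v F)"
    using branch_uniform[OF F(1)] v(2) by blast
  ultimately show ?case
    using branch_binary[OF v] branch_not_colorable[OF not_colorable] by blast
qed

end
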